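(* Let $n\ge1$ and define $\varepsilon_n>0$ by $(1+\varepsilon_n)^2=1+8190\,e^{-n/10}$. For every $f(t)=\sum_{j=1}^na_je^{i\lambda_jt}$ with $a_j\in\mathbb{C}$ and real $\lambda_1<\cdots<\lambda_n$, $$|f'(0)| \le (1+\varepsilon_n)\left(27n^5+\sum_{k=1}^n\lambda_k^2\right)^{1/2}\|f\|_{[0,1]}$$ and $$\|f'\|_{[0,1]} \le (1+\varepsilon_n)\left(108n^5+\sum_{k=1}^n\lambda_k^2\right)^{1/2}\|f\|_{[0,1]}.$$
   Context: $\|g\|_{[0,1]}:=\sup_{t\in[0,1]}|g(t)|$. *)

theory Defs
  imports "HOL-Analysis.Analysis"
begin

definition supnorm01 :: "(real \<Rightarrow> complex) \<Rightarrow> real" where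
  "supnorm01 g = (SUP t\<in>{0..1}. norm (g t))"

definition eps :: "nat \<Rightarrow> real" where
  "eps n = sqrt (1 + 8190 * exp (- real n / 10)) - 1"

definition expsum :: "nat \<Rightarrow> (nat \<Rightarrow> complex) \<Rightarrow> (nat \<Rightarrow> real) \<Rightarrow> real \<Rightarrow> complex" where
  "expsum n a lam t = (\<Sum>j=1..n. a j * exp (\<i> * complex_of_real (lam j * t)))"

end

theory Submission
  imports Defs
begin

text \<open>
  Let \<open>c = 9n\<close> and write \<open>Q\<close> for the integral of \<open>|f(t)|\<^sup>2 e\<^sup>-\<^sup>c\<^sup>t\<close> over the half line, a Hermitian form
  in the coefficients with entries \<open>1 / (c - i(\<lambda>\<^sub>j - \<lambda>\<^sub>k))\<close>.  Removing the frequencies one at a time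
  with an all-pass (Blaschke) factor splits off a square from \<open>Q\<close>, which amounts to expanding \<open>f\<close> in
  the orthonormal Takenaka-Malmquist system, and Cauchy-Schwarz gives
  \<open>|f'(0)|\<^sup>2 \<le> c (\<Sum> \<lambda>\<^sub>k\<^sup>2 + c\<^sup>2 \<Sum>i<n. i\<^sup>2) Q\<close>.  Conversely \<open>c Q\<close> exceeds the squared sup norm on
  \<open>[0,1]\<close> only by an exponentially small factor, because a Turan-type estimate
  \<open>|f(t)| \<le> 3\<^sup>n\<^sup>t\<^sup>+\<^sup>1 \<parallel>f\<parallel>\<close> for \<open>t \<ge> 1\<close> is beaten by the weight.  The bound for \<open>f'\<close> on all of
  \<open>[0,1]\<close> is the first one applied on an interval of length \<open>1/2\<close> having the point as an endpoint.
\<close>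

section \<open>The Gram form and the derivative functional\<close>

definition gram :: "nat \<Rightarrow> real \<Rightarrow> (nat \<Rightarrow> real) \<Rightarrow> (nat \<Rightarrow> complex) \<Rightarrow> complex" where
  "gram n c lam a =
     (\<Sum>j=1..n. \<Sum>k=1..n. a j * cnj (a k) / (of_real c - \<i> * of_real (lam j - lam k)))"

lemma shifted_ne_0:
  fixes c d :: real
  assumes "c > 0"
  shows "of_real c - \<i> * of_real d \<noteq> (0::complex)" "of_real c + \<i> * of_real d \<noteq> (0::complex)"
  using assms by (auto simp: complex_eq_iff)

text \<open>With \<open>v(d) = -i d / (c - i d)\<close>, the value of the all-pass factor
  \<open>(s - c/2) / (s + c/2)\<close> at \<open>s = c/2 - i d\<close>, one has
  \<open>(c - i d)(c + i e) (1 - v(d) cnj (v(e))) = c (c - i (d - e))\<close>. Division turns this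
  into a Gram entry weighted by \<open>v\<close> plus a rank-one term, the source of the split-off
  square.\<close>

lemma gram_entry_split:
  fixes c d e :: real
  assumes c: "c > 0"
  shows "1 / (of_real c - \<i> * of_real (d - e) :: complex) =
     (- \<i> * of_real d / (of_real c - \<i> * of_real d)) *
     cnj (- \<i> * of_real e / (of_real c - \<i> * of_real e)) / (of_real c - \<i> * of_real (d - e))
     + of_real c / ((of_real c - \<i> * of_real d) * cnj (of_real c - \<i> * of_real e))"
proof -
  define C D E :: complex where "C = of_real c" and "D = \<i> * of_real d" and "E = \<i> * of_real e"
  have nz: "C - D \<noteq> 0" "C + E \<noteq> 0" "C - (D - E) \<noteq> 0"
    using shifted_ne_0[OF c, of d] shifted_ne_0[OF c, of e] shifted_ne_0[OF c, of "d - e"]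
    by (auto simp: C_def D_def E_def algebra_simps)
  have "1 / (C - (D - E)) = (- D / (C - D)) * (E / (C + E)) / (C - (D - E)) + C / ((C - D) * (C + E))"
    using nz by (simp add: divide_simps) (simp add: algebra_simps)
  then show ?thesis
    by (simp add: C_def D_def E_def algebra_simps)
qed

text \<open>The cross term satisfies \<open>2 x y \<le> \<alpha> q + \<beta> p\<close> by the
  arithmetic-geometric mean inequality. Thus the constant of the smaller form and that of a
  split-off square simply add up.\<close>

lemma cauchy_schwarz_two:
  fixes x y \<alpha> \<beta> p q :: real
  assumes "x\<^sup>2 \<le> \<alpha> * p" "y\<^sup>2 \<le> \<beta> * q" "\<alpha> \<ge> 0" "\<beta> \<ge> 0" "p \<ge> 0" "q \<ge> 0" "x \<ge> 0" "y \<ge> 0"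
  shows "(x + y)\<^sup>2 \<le> (\<alpha> + \<beta>) * (p + q)"
proof -
  have "(x * y)\<^sup>2 \<le> (\<alpha> * p) * (\<beta> * q)"
    unfolding power_mult_distrib using assms by (intro mult_mono) auto
  also have "\<dots> = (\<alpha> * q) * (\<beta> * p)" by simp
  also have "4 * \<dots> \<le> (\<alpha> * q + \<beta> * p)\<^sup>2"
    using sum_squares_bound[of "\<alpha> * q" "\<beta> * p"] by (simp add: power2_sum mult_ac)
  finally have "(2 * (x * y))\<^sup>2 \<le> (\<alpha> * q + \<beta> * p)\<^sup>2"
    by (simp add: power_mult_distrib)
  then have "2 * (x * y) \<le> \<alpha> * q + \<beta> * p"
    using assms by (intro power2_le_imp_le[of "2 * (x * y)"]) auto
  with assms(1,2) show ?thesis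
    by (simp add: power2_sum algebra_simps)
qed

text \<open>
  The parameter \<open>\<gamma>\<close> makes the induction work: removing the last frequency turns \<open>\<gamma>\<close> into \<open>\<gamma> + c\<close>.
\<close>

lemma derivative_functional_bound:
  fixes c \<gamma> :: real
  assumes c: "c > 0"
  shows "0 \<le> Re (gram n c lam a) \<and>
    (norm (\<Sum>j=1..n. (\<i> * of_real (lam j) - of_real \<gamma>) * a j))\<^sup>2
      \<le> c * ((\<Sum>k=1..n. (lam k)\<^sup>2) + (\<Sum>i<n. (\<gamma> + real i * c)\<^sup>2)) * Re (gram n c lam a)"
proof (induction n arbitrary: a \<gamma>)
  case 0
  then show ?case by (simp add: gram_def)
next
  case (Suc n)
  define N where "N = Suc n"
  \<comment> \<open>Gram entries depend only on differences of frequencies, so the last one may be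
    moved to 0, the zero of the all-pass factor; this makes \<open>a' N\<close> vanish.\<close>
  define d where "d j = lam j - lam N" for j
  define u :: "nat \<Rightarrow> complex" where "u j = of_real c - \<i> * of_real (d j)" for j
  define v :: "nat \<Rightarrow> complex" where "v j = - \<i> * of_real (d j) / u j" for j
  define a' where "a' j = v j * a j" for j
  define s where "s = (\<Sum>j=1..N. a j / u j)"
  have u0: "u j \<noteq> 0" for j
    unfolding u_def by (rule shifted_ne_0[OF c])
  have a'N: "a' N = 0"
    by (simp add: a'_def v_def d_def)
  have entry: "a j * cnj (a k) / (of_real c - \<i> * of_real (lam j - lam k)) =
      a' j * cnj (a' k) / (of_real c - \<i> * of_real (lam j - lam k))
      + of_real c * ((a j / u j) * cnj (a k / u k))" for j k
  proof -
    define X where "X = of_real c - \<i> * complex_of_real (lam j - lam k)"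
    have "1 / X = v j * cnj (v k) / X + of_real c / (u j * cnj (u k))"
      using gram_entry_split[OF c, of "d j" "d k"] by (simp add: X_def u_def v_def d_def)
    from arg_cong[OF this, of "\<lambda>x. a j * cnj (a k) * x"]
    have "a j * cnj (a k) / X = a' j * cnj (a' k) / X + of_real c * ((a j / u j) * cnj (a k / u k))"
      by (simp add: a'_def distrib_left mult_ac)
    then show ?thesis by (simp only: X_def)
  qed
  have "gram N c lam a = gram N c lam a' + of_real c * (s * cnj s)"
    unfolding gram_def s_def entry cnj_sum sum_product
    by (simp add: sum.distrib sum_distrib_left)
  also have "gram N c lam a' = gram n c lam a'"
    unfolding gram_def N_def using a'N by (simp add: N_def)
  finally have gram: "Re (gram N c lam a) = Re (gram n c lam a') + c * (norm s)\<^sup>2"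
    by (simp add: complex_mult_cnj cmod_power2)
  define A where "A = (\<Sum>j=1..n. (\<i> * of_real (lam j) - of_real (\<gamma> + c)) * a' j)"
  define B where "B = of_real c * (\<i> * of_real (lam N) - of_real \<gamma>) * s"
  \<comment> \<open>Multiplying the weight by \<open>u j\<close> leaves, besides a multiple of
    \<open>d j\<close> with \<open>\<gamma> + c\<close> for \<open>\<gamma>\<close>, a term that is
    the same for all \<open>j\<close>; its sum is therefore a multiple of \<open>s\<close>.\<close>
  have "(\<i> * of_real (lam j) - of_real \<gamma>) * a j =
      (\<i> * of_real (lam j) - of_real (\<gamma> + c)) * a' j
      + of_real c * (\<i> * of_real (lam N) - of_real \<gamma>) * (a j / u j)" for j
  proof -
    have "(\<i> * of_real (lam j) - of_real \<gamma>) * a j =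
      ((\<i> * of_real (lam j) - of_real \<gamma>) * u j) * (a j / u j)"
      using u0[of j] by simp
    also have "(\<i> * of_real (lam j) - of_real \<gamma>) * u j =
      (\<i> * of_real (lam j) - of_real (\<gamma> + c)) * (- \<i> * of_real (d j))
      + of_real c * (\<i> * of_real (lam N) - of_real \<gamma>)"
      by (simp add: u_def d_def algebra_simps)
    finally show ?thesis
      by (simp only: a'_def v_def distrib_right) simp
  qed
  then have "(\<Sum>j=1..N. (\<i> * of_real (lam j) - of_real \<gamma>) * a j) =
      (\<Sum>j=1..N. (\<i> * of_real (lam j) - of_real (\<gamma> + c)) * a' j) + B"
    unfolding B_def s_def by (simp only: sum.distrib sum_distrib_left)
  also have "(\<Sum>j=1..N. (\<i> * of_real (lam j) - of_real (\<gamma> + c)) * a' j) = A"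
    unfolding A_def N_def using a'N by (simp add: N_def)
  finally have split: "(\<Sum>j=1..N. (\<i> * of_real (lam j) - of_real \<gamma>) * a j) = A + B" .
  define \<alpha> where "\<alpha> = c * ((\<Sum>k=1..n. (lam k)\<^sup>2) + (\<Sum>i<n. (\<gamma> + c + real i * c)\<^sup>2))"
  define \<beta> where "\<beta> = c * ((lam N)\<^sup>2 + \<gamma>\<^sup>2)"
  have IH: "0 \<le> Re (gram n c lam a')" "(norm A)\<^sup>2 \<le> \<alpha> * Re (gram n c lam a')"
    using Suc.IH[of a' "\<gamma> + c"] by (simp_all add: A_def \<alpha>_def)
  have "(norm (\<i> * of_real (lam N) - of_real \<gamma>))\<^sup>2 = (lam N)\<^sup>2 + \<gamma>\<^sup>2"
    by (simp add: cmod_power2)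
  then have B: "(norm B)\<^sup>2 = \<beta> * (c * (norm s)\<^sup>2)"
    by (simp only: B_def \<beta>_def norm_mult norm_of_real power_mult_distrib power2_abs)
      (simp add: power2_eq_square)
  have "(norm (A + B))\<^sup>2 \<le> (norm A + norm B)\<^sup>2"
    by (intro power_mono norm_triangle_ineq) auto
  also have "\<dots> \<le> (\<alpha> + \<beta>) * (Re (gram n c lam a') + c * (norm s)\<^sup>2)"
    using IH B c by (intro cauchy_schwarz_two) (auto simp: \<alpha>_def \<beta>_def intro!: mult_nonneg_nonneg add_nonneg_nonneg sum_nonneg)
  \<comment> \<open>The new \<open>\<gamma>\<close> square is the term \<open>i = 0\<close>; the
    shift by \<open>c\<close> moves the old terms to \<open>i + 1\<close>.\<close>
  also have "\<alpha> + \<beta> = c * ((\<Sum>k=1..N. (lam k)\<^sup>2) + (\<Sum>i<N. (\<gamma> + real i * c)\<^sup>2))"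
    unfolding N_def sum.lessThan_Suc_shift by (simp add: \<alpha>_def \<beta>_def N_def algebra_simps)
  finally have "(norm (A + B))\<^sup>2 \<le>
      c * ((\<Sum>k=1..N. (lam k)\<^sup>2) + (\<Sum>i<N. (\<gamma> + real i * c)\<^sup>2)) * Re (gram N c lam a)"
    by (simp only: gram)
  moreover have "0 \<le> Re (gram N c lam a)"
    using IH(1) c by (simp add: gram)
  ultimately show ?case
    using split by (simp only: N_def)
qed

section \<open>Growth of exponential sums outside the unit interval\<close>

text \<open>The combination \<open>x (k + 1) - z x k\<close> with \<open>z\<close> the last node
  annihilates that node, at the cost of a factor 2 in the initial bound. Solving this recurrence for
  \<open>x\<close> adds one more copy of the bound per step, and 2 + 1 = 3 is the growth rate for
  every \<open>n\<close>.\<close>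

lemma power_sum_growth:
  fixes z b :: "nat \<Rightarrow> complex"
  assumes z: "\<And>j. norm (z j) = 1"
    and M: "M \<ge> 0" "\<And>k. k < n \<Longrightarrow> norm (\<Sum>j=1..n. b j * z j ^ k) \<le> M"
  shows "norm (\<Sum>j=1..n. b j * z j ^ m) \<le> 3 ^ m * M"
  using M
proof (induction n arbitrary: b M m)
  case 0
  then show ?case by simp
next
  case (Suc n)
  define x where "x k = (\<Sum>j=1..Suc n. b j * z j ^ k)" for k
  define b' where "b' j = b j * (z j - z (Suc n))" for j
  have rec: "(\<Sum>j=1..n. b' j * z j ^ k) = x (Suc k) - z (Suc n) * x k" for k
  proof -
    have "x (Suc k) - z (Suc n) * x k = (\<Sum>j=1..Suc n. b' j * z j ^ k)"
      unfolding x_def b'_def sum_distrib_left sum_subtractf[symmetric]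
      by (intro sum.cong) (auto simp: algebra_simps)
    then show ?thesis by (simp add: b'_def)
  qed
  have x: "norm (x k) \<le> M" if "k < Suc n" for k
    using Suc.prems(2)[OF that] by (simp add: x_def)
  have diff: "norm (\<Sum>j=1..n. b' j * z j ^ k) \<le> 3 ^ k * (2 * M)" for k
  proof (rule Suc.IH)
    fix k assume k: "k < n"
    have "norm (x (Suc k) - z (Suc n) * x k) \<le> norm (x (Suc k)) + norm (z (Suc n) * x k)"
      by (rule norm_triangle_ineq4)
    then show "norm (\<Sum>j=1..n. b' j * z j ^ k) \<le> 2 * M"
      unfolding rec using x[of k] x[of "Suc k"] k by (simp add: norm_mult z)
  qed (use Suc.prems in auto)
  have "norm (x m) \<le> 3 ^ m * M" for m
  proof (induction m)
    case 0
    show ?case using x[of 0] by simp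
  next
    case (Suc m)
    have "x (Suc m) = (\<Sum>j=1..n. b' j * z j ^ m) + z (Suc n) * x m"
      unfolding rec by simp
    then have "norm (x (Suc m)) \<le> norm (\<Sum>j=1..n. b' j * z j ^ m) + norm (z (Suc n) * x m)"
      by (metis norm_triangle_ineq)
    also have "\<dots> \<le> 3 ^ m * (2 * M) + 3 ^ m * M"
      using diff[of m] Suc.IH by (intro add_mono) (simp_all add: norm_mult z)
    finally show ?case by (simp add: mult.commute)
  qed
  then show ?case by (simp add: x_def)
qed

text \<open>Sampling with step \<open>h = t / m\<close>, where \<open>m\<close> is
  \<open>n t\<close> rounded up, makes \<open>t\<close> the \<open>m\<close>-th sample, while the
  first \<open>n\<close> samples stay in the unit interval because \<open>n h \<le> 1\<close>. Then
  \<open>m \<le> n t + 1\<close>, and squaring gives the base 9, which is at most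
  \<open>exp 3\<close>.\<close>

lemma expsum_growth:
  assumes n: "n \<ge> 1" and t: "t \<ge> 1"
    and M: "\<And>s. 0 \<le> s \<Longrightarrow> s \<le> 1 \<Longrightarrow> norm (expsum n a lam s) \<le> M"
  shows "(norm (expsum n a lam t))\<^sup>2 \<le> 9 * exp (3 * real n * t) * M\<^sup>2"
proof -
  define m where "m = nat \<lceil>real n * t\<rceil>"
  define h where "h = t / real m"
  have nt: "real n * t \<ge> 1"
    using n t mult_mono[of 1 "real n" 1 t] by simp
  then have m1: "real m \<ge> real n * t" and m2: "real m \<le> real n * t + 1"
    unfolding m_def by linarith+
  with nt have m0: "real m > 0" by linarith
  define z where "z j = exp (\<i> * complex_of_real (lam j * h))" for j
  have z: "norm (z j) = 1" for j
    by (simp add: z_def norm_exp_i_times flip: of_real_mult)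
  have pow: "z j ^ k = exp (\<i> * complex_of_real (lam j * (real k * h)))" for j k
    by (simp add: z_def exp_of_nat_mult[symmetric] algebra_simps)
  have M0: "M \<ge> 0"
    using order_trans[OF norm_ge_zero M[of 0]] by simp
  have h: "h \<ge> 0" "real n * h \<le> 1"
    using m0 m1 t by (simp_all add: h_def divide_simps)
  have "norm (\<Sum>j=1..n. a j * z j ^ m) \<le> 3 ^ m * M"
  proof (rule power_sum_growth[OF z M0])
    fix k assume "k < n"
    then have "real k * h \<le> real n * h"
      using h(1) by (intro mult_right_mono) auto
    with h have "0 \<le> real k * h" "real k * h \<le> 1" by auto
    from M[OF this] show "norm (\<Sum>j=1..n. a j * z j ^ k) \<le> M"
      by (simp add: pow expsum_def)
  qed
  moreover have "real m * h = t"
    using m0 by (simp add: h_def)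
  ultimately have "norm (expsum n a lam t) \<le> 3 ^ m * M"
    by (simp add: pow expsum_def)
  then have "(norm (expsum n a lam t))\<^sup>2 \<le> (3 ^ m * M)\<^sup>2"
    by (intro power_mono) auto
  also have "\<dots> = (3 * 3) ^ m * M\<^sup>2"
    by (simp only: power_mult_distrib power2_eq_square mult_ac)
  also have "3 * 3 = (9::real)" by simp
  also have "9 ^ m * M\<^sup>2 \<le> 9 * exp (3 * real n * t) * M\<^sup>2"
  proof (rule mult_right_mono)
    have "(9::real) ^ m = 9 powr real m"
      by (simp add: powr_realpow)
    also have "\<dots> \<le> 9 powr (real n * t + 1)"
      using m2 by (intro powr_mono) auto
    also have "\<dots> = 9 * 9 powr (real n * t)"
      by (simp add: powr_add)
    also have "9 powr (real n * t) \<le> exp 3 powr (real n * t)"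
    proof (rule powr_mono2)
      \<comment> \<open>Eight factors suffice: 1.375 to the power 8 is about 12.8.\<close>
      have "(9::real) \<le> (1 + 3 / real 8) ^ 8" by (simp add: eval_nat_numeral)
      also have "\<dots> \<le> exp 3" by (rule exp_ge_one_plus_x_over_n_power_n) auto
      finally show "(9::real) \<le> exp 3" .
    qed (use nt in auto)
    also have "exp 3 powr (real n * t) = exp (3 * real n * t)"
      by (simp add: powr_def algebra_simps)
    finally show "(9::real) ^ m \<le> 9 * exp (3 * real n * t)" by simp
  qed auto
  finally show ?thesis .
qed

section \<open>The Gram form against the sup norm\<close>

text \<open>
  \<open>gram n c lam a\<close> is the integral over the half line of the squared modulus against \<open>e\<^sup>-\<^sup>c\<^sup>t\<close>.  Instead of
  integrating, we compare \<open>g t\<close>, the integral over \<open>{t..}\<close>, with the integral \<open>k t\<close> of the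
  majorant \<open>M\<^sup>2 (1 + 9 e\<^sup>-\<^sup>5\<^sup>n e\<^sup>8\<^sup>n\<^sup>t)\<close> of the squared modulus, valid for all \<open>t \<ge> 0\<close>.
\<close>

lemma gram_upper_bound:
  assumes n: "n \<ge> 1"
    and M: "\<And>s. 0 \<le> s \<Longrightarrow> s \<le> 1 \<Longrightarrow> norm (expsum n a lam s) \<le> M"
  shows "9 * real n * Re (gram n (9 * real n) lam a) \<le> (1 + 81 * exp (- 5 * real n)) * M\<^sup>2"
proof -
  define c where "c = 9 * real n"
  have c: "c > 0" using n by (simp add: c_def)
  define \<delta> :: "nat \<Rightarrow> nat \<Rightarrow> complex"
    where "\<delta> j k = of_real c - \<i> * of_real (lam j - lam k)" for j k
  have \<delta>0: "\<delta> j k \<noteq> 0" for j k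
    unfolding \<delta>_def by (rule shifted_ne_0[OF c])
  define g where "g t = (\<Sum>j=1..n. \<Sum>k=1..n. a j * cnj (a k) / \<delta> j k * exp (- \<delta> j k * of_real t))" for t :: real
  define k where "k t = M\<^sup>2 * (exp (- c * t) / c + 9 * exp (- 5 * real n) * exp (- real n * t) / real n)" for t
  have dg: "(g has_vector_derivative
      - of_real ((norm (expsum n a lam t))\<^sup>2 * exp (- c * t))) (at t)" for t
  proof -
    have "(g has_vector_derivative
      (\<Sum>j=1..n. \<Sum>k=1..n. - (a j * cnj (a k) * exp (- \<delta> j k * of_real t)))) (at t)"
      unfolding g_def
    proof (intro has_vector_derivative_sum)
      fix j l
      have "((\<lambda>w. a j * cnj (a l) / \<delta> j l * exp (- \<delta> j l * w)) has_field_derivative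
          - (a j * cnj (a l) * exp (- \<delta> j l * of_real t))) (at (of_real t))"
        using \<delta>0[of j l] by (auto intro!: derivative_eq_intros)
      from has_vector_derivative_real_field[OF this]
      show "((\<lambda>x. a j * cnj (a l) / \<delta> j l * exp (- \<delta> j l * of_real x)) has_vector_derivative
          - (a j * cnj (a l) * exp (- \<delta> j l * of_real t))) (at t)" .
    qed
    also have "(\<Sum>j=1..n. \<Sum>k=1..n. - (a j * cnj (a k) * exp (- \<delta> j k * of_real t))) =
       - (expsum n a lam t * cnj (expsum n a lam t) * of_real (exp (- c * t)))"
    proof -
      have prod: "a j * cnj (a k) * exp (- \<delta> j k * of_real t) = (a j * exp (\<i> * complex_of_real (lam j * t))) *
         (cnj (a k) * cnj (exp (\<i> * complex_of_real (lam k * t)))) * of_real (exp (- c * t))" for j k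
        by (simp add: \<delta>_def exp_cnj exp_of_real[symmetric] exp_add[symmetric] algebra_simps)
      show ?thesis
        unfolding expsum_def cnj_sum complex_cnj_mult sum_product unfolding sum_distrib_right sum_negf prod ..
    qed
    also have "\<dots> = - of_real ((norm (expsum n a lam t))\<^sup>2 * exp (- c * t))"
      by (simp only: complex_norm_square[symmetric] of_real_mult)
    finally show ?thesis .
  qed
  have dRe: "((\<lambda>t. Re (g t)) has_real_derivative
      - ((norm (expsum n a lam t))\<^sup>2 * exp (- c * t))) (at t)" for t
    using bounded_linear.has_vector_derivative[OF bounded_linear_Re dg[of t]]
    by (simp add: has_real_derivative_iff_has_vector_derivative)
  have dk: "(k has_real_derivative
      - (M\<^sup>2 * (1 + 9 * exp (- 5 * real n) * exp (8 * real n * t)) * exp (- c * t))) (at t)" for t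
  proof -
    have "exp (8 * real n * t) * exp (- c * t) = exp (- real n * t)"
      by (simp add: c_def exp_add[symmetric])
    then show ?thesis
      unfolding k_def using c n
      by (auto intro!: derivative_eq_intros simp: algebra_simps)
  qed
  \<comment> \<open>The rate \<open>8 n\<close> stays below the weight \<open>9 n\<close>, so the
    majorant leaves a tail decaying like \<open>exp (- n t)\<close>. The prefactor
    \<open>exp (- 5 n)\<close> makes it agree with the growth rate \<open>3 n\<close> at
    \<open>t = 1\<close>, and from there on it is the larger one.\<close>
  have bound: "(norm (expsum n a lam t))\<^sup>2 \<le> M\<^sup>2 * (1 + 9 * exp (- 5 * real n) * exp (8 * real n * t))"
    if t: "t \<ge> 0" for t
  proof (cases "t \<le> 1")
    case True
    have "(norm (expsum n a lam t))\<^sup>2 \<le> M\<^sup>2"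
      using M[OF t True] by (intro power_mono) auto
    also have "\<dots> \<le> M\<^sup>2 * (1 + 9 * exp (- 5 * real n) * exp (8 * real n * t))"
      by (simp add: distrib_left)
    finally show ?thesis .
  next
    case False
    have "real n * 1 \<le> real n * t" using False by (intro mult_left_mono) auto
    then have "3 * real n * t \<le> - 5 * real n + 8 * real n * t" by linarith
    then have "exp (3 * real n * t) \<le> exp (- 5 * real n + 8 * real n * t)"
      by (simp only: exp_le_cancel_iff)
    then have "9 * exp (3 * real n * t) \<le> 1 + 9 * exp (- 5 * real n) * exp (8 * real n * t)"
      by (simp only: exp_add mult.assoc)
    then have "M\<^sup>2 * (9 * exp (3 * real n * t)) \<le> M\<^sup>2 * (1 + 9 * exp (- 5 * real n) * exp (8 * real n * t))"
      by (intro mult_left_mono) auto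
    with expsum_growth[OF n, of t a lam M] False M show ?thesis
      by (simp add: mult.commute)
  qed
  \<comment> \<open>A nondecreasing difference with limit 0 at infinity is at most 0 at the
    origin.\<close>
  have mono: "Re (g 0) - k 0 \<le> Re (g t) - k t" if "t \<ge> 0" for t
  proof (rule DERIV_nonneg_imp_nondecreasing[OF that])
    fix x :: real assume "0 \<le> x" "x \<le> t"
    then have "(norm (expsum n a lam x))\<^sup>2 * exp (- c * x) \<le>
      M\<^sup>2 * (1 + 9 * exp (- 5 * real n) * exp (8 * real n * x)) * exp (- c * x)"
      using bound by (intro mult_right_mono) auto
    then show "\<exists>y. ((\<lambda>t. Re (g t) - k t) has_real_derivative y) (at x) \<and> 0 \<le> y"
      using DERIV_diff[OF dRe[of x] dk[of x]] by (intro exI conjI) auto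
  qed
  have decay: "((\<lambda>t. exp (- b * t)) \<longlongrightarrow> 0) at_top" if "b > 0" for b :: real
  proof (rule filterlim_compose[OF exp_at_bot])
    show "filterlim (\<lambda>t. - b * t) at_bot at_top"
      using that by (intro filterlim_tendsto_neg_mult_at_bot[OF tendsto_const] filterlim_ident) auto
  qed
  have "(g \<longlongrightarrow> (\<Sum>j=1..n. \<Sum>k=1..n. a j * cnj (a k) / \<delta> j k * 0)) at_top"
    unfolding g_def
  proof (intro tendsto_sum tendsto_mult tendsto_const)
    fix j l
    have "norm (exp (- \<delta> j l * of_real t)) = exp (- c * t)" for t
      by (simp add: \<delta>_def)
    with decay[OF c] show "((\<lambda>t. exp (- \<delta> j l * of_real t)) \<longlongrightarrow> 0) at_top"
      by (intro tendsto_norm_zero_cancel[where f = "\<lambda>t. exp (- \<delta> j l * of_real t)"]) (simp only:)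
  qed
  then have "((\<lambda>t. Re (g t)) \<longlongrightarrow> 0) at_top"
    using tendsto_Re[of g 0 at_top] by simp
  moreover have "(k \<longlongrightarrow> M\<^sup>2 * (0 / c + 9 * exp (- 5 * real n) * 0 / real n)) at_top"
    unfolding k_def using c n by (intro tendsto_intros decay) auto
  ultimately have "((\<lambda>t. Re (g t) - k t) \<longlongrightarrow> 0) at_top"
    using tendsto_diff[of "\<lambda>t. Re (g t)" 0 at_top k 0] by simp
  then have "Re (g 0) - k 0 \<le> 0"
    by (rule tendsto_lowerbound) (auto intro: mono eventually_mono[OF eventually_ge_at_top[of 0]])
  moreover have "g 0 = gram n c lam a"
    by (simp add: g_def gram_def \<delta>_def)
  ultimately have "c * Re (gram n c lam a) \<le> c * k 0"
    using c by (intro mult_left_mono) auto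
  \<comment> \<open>Here 81 is the 9 of the growth bound times \<open>c / n = 9\<close>.\<close>
  also have "c * k 0 = (1 + 81 * exp (- 5 * real n)) * M\<^sup>2"
    using n by (simp add: k_def c_def field_simps)
  finally show ?thesis by (simp add: c_def)
qed

section \<open>The bound at the endpoint\<close>

lemma sum_squares_le_cube: "3 * (\<Sum>i<n. (real i)\<^sup>2) \<le> real n ^ 3"
  by (induction n) (auto simp: power2_eq_square power3_eq_cube algebra_simps)

text \<open>The two estimates of the Gram form combine at \<open>\<gamma> = 0\<close>, where the
  functional is the derivative at 0. Working with coefficients and an arbitrary pointwise bound
  \<open>M\<close> lets the result apply to rescaled and reflected sums.\<close>

lemma derivative_at_endpoint:
  assumes n: "n \<ge> 1"
    and M: "\<And>s. 0 \<le> s \<Longrightarrow> s \<le> 1 \<Longrightarrow> norm (expsum n a lam s) \<le> M"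
  shows "(norm (\<Sum>j=1..n. \<i> * of_real (lam j) * a j))\<^sup>2
     \<le> (1 + eps n)\<^sup>2 * (27 * real n ^ 5 + (\<Sum>k=1..n. (lam k)\<^sup>2)) * M\<^sup>2"
proof -
  define c where "c = 9 * real n"
  have c: "c > 0" using n by (simp add: c_def)
  let ?Q = "Re (gram n c lam a)" and ?L = "\<Sum>k=1..n. (lam k)\<^sup>2"
  have L: "?L \<ge> 0" by (intro sum_nonneg) auto
  have *: "0 \<le> ?Q" "(norm (\<Sum>j=1..n. \<i> * of_real (lam j) * a j))\<^sup>2
      \<le> c * (?L + (\<Sum>i<n. (real i * c)\<^sup>2)) * ?Q"
    using derivative_functional_bound[OF c, of n lam a 0] by auto
  \<comment> \<open>The constant 27 is 81 / 3: the square of \<open>c = 9 n\<close> times the bound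
    \<open>n^3 / 3\<close> for the sum of squares.\<close>
  have "(\<Sum>i<n. (real i * c)\<^sup>2) = 27 * (real n)\<^sup>2 * (3 * (\<Sum>i<n. (real i)\<^sup>2))"
    by (simp add: c_def sum_distrib_left power_mult_distrib mult_ac)
  also have "\<dots> \<le> 27 * (real n)\<^sup>2 * real n ^ 3"
    by (intro mult_left_mono sum_squares_le_cube) auto
  also have "\<dots> = 27 * real n ^ 5"
    by (simp flip: power_add)
  finally have "(?L + (\<Sum>i<n. (real i * c)\<^sup>2)) * (c * ?Q) \<le> (27 * real n ^ 5 + ?L) * (c * ?Q)"
    using c *(1) by (intro mult_right_mono) auto
  also have "c * ?Q \<le> (1 + eps n)\<^sup>2 * M\<^sup>2"
  proof -
    have "exp (- 5 * real n) \<le> exp (- real n / 10)" by simp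
    then have "1 + 81 * exp (- 5 * real n) \<le> 1 + 8190 * exp (- real n / 10)"
      using exp_gt_zero[of "- real n / 10"] by linarith
    also have "\<dots> = (1 + eps n)\<^sup>2"
      by (simp add: eps_def add_nonneg_nonneg)
    finally have "(1 + 81 * exp (- 5 * real n)) * M\<^sup>2 \<le> (1 + eps n)\<^sup>2 * M\<^sup>2"
      by (intro mult_right_mono) auto
    with gram_upper_bound[OF n M] show ?thesis by (simp add: c_def)
  qed
  finally have "(?L + (\<Sum>i<n. (real i * c)\<^sup>2)) * (c * ?Q)
      \<le> (27 * real n ^ 5 + ?L) * ((1 + eps n)\<^sup>2 * M\<^sup>2)"
    using L by (simp add: mult_left_mono)
  with *(2) show ?thesis by (simp only: mult_ac)
qed

section \<open>From the endpoint to the whole interval\<close>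

lemma has_vector_derivative_expsum:
  "(expsum n a lam has_vector_derivative
     (\<Sum>j=1..n. \<i> * of_real (lam j) * (a j * exp (\<i> * complex_of_real (lam j * t))))) (at t)"
  unfolding expsum_def
proof (intro has_vector_derivative_sum)
  fix j
  have "((\<lambda>w. a j * exp (\<i> * (of_real (lam j) * w))) has_field_derivative
      \<i> * of_real (lam j) * (a j * exp (\<i> * (of_real (lam j) * of_real t)))) (at (of_real t))"
    by (auto intro!: derivative_eq_intros)
  from has_vector_derivative_real_field[OF this]
  show "((\<lambda>t. a j * exp (\<i> * complex_of_real (lam j * t))) has_vector_derivative
      \<i> * of_real (lam j) * (a j * exp (\<i> * complex_of_real (lam j * t)))) (at t)"
    by simp
qed

lemma norm_expsum_le_supnorm01:
  assumes "0 \<le> t" "t \<le> 1"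
  shows "norm (expsum n a lam t) \<le> supnorm01 (expsum n a lam)"
  unfolding supnorm01_def
proof (rule cSUP_upper)
  \<comment> \<open>A real supremum dominates its members only if the set is bounded above; the
    exponentials being unimodular, the coefficients give a bound.\<close>
  have "norm (expsum n a lam s) \<le> (\<Sum>j=1..n. norm (a j))" for s
    unfolding expsum_def by (rule norm_sum[THEN order.trans]) (simp add: norm_mult flip: of_real_mult)
  then show "bdd_above ((\<lambda>t. norm (expsum n a lam t)) ` {0..1})"
    by (intro bdd_aboveI2)
qed (use assms in auto)

lemma one_plus_eps_nonneg: "0 \<le> 1 + eps n"
  by (simp add: eps_def add_nonneg_nonneg)

lemma le_mult_sqrt_mult:
  fixes x e y M :: real
  assumes "x\<^sup>2 \<le> e\<^sup>2 * y * M\<^sup>2" "0 \<le> e" "0 \<le> y" "0 \<le> M"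
  shows "x \<le> e * sqrt y * M"
  by (rule power2_le_imp_le) (use assms in \<open>auto simp: power_mult_distrib\<close>)

text \<open>
  For \<open>\<sigma> = 1\<close> (\<open>t \<le> 1/2\<close>) or \<open>\<sigma> = -1\<close> (\<open>t \<ge> 1/2\<close>), the function \<open>s \<mapsto> f (t + \<sigma> s / 2)\<close> is an exponential sum
  with frequencies \<open>\<sigma> \<lambda>\<^sub>j / 2\<close>.
\<close>

lemma derivative_inside:
  assumes n: "n \<ge> 1" and t: "0 \<le> t" "t \<le> 1"
  shows "norm (vector_derivative (expsum n a lam) (at t))
    \<le> (1 + eps n) * sqrt (108 * real n ^ 5 + (\<Sum>k=1..n. (lam k)\<^sup>2)) * supnorm01 (expsum n a lam)"
proof -
  let ?M = "supnorm01 (expsum n a lam)"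
  define \<sigma> :: real where "\<sigma> = (if t \<le> 1/2 then 1 else -1)"
  have \<sigma>: "\<sigma>\<^sup>2 = 1" "\<bar>\<sigma>\<bar> = 1" by (auto simp: \<sigma>_def)
  define b where "b j = a j * exp (\<i> * complex_of_real (lam j * t))" for j
  define mu where "mu j = \<sigma> * lam j / 2" for j
  have shift: "expsum n b mu s = expsum n a lam (t + \<sigma> * s / 2)" for s
    unfolding expsum_def b_def mu_def
    by (intro sum.cong refl) (simp add: exp_add[symmetric] algebra_simps)
  have "norm (expsum n b mu s) \<le> ?M" if "0 \<le> s" "s \<le> 1" for s
    unfolding shift using that t by (intro norm_expsum_le_supnorm01) (auto simp: \<sigma>_def)
  note bd = derivative_at_endpoint[OF n this]
  have "(\<Sum>j=1..n. \<i> * of_real (mu j) * b j) = of_real (\<sigma> / 2) * (\<Sum>j=1..n. \<i> * of_real (lam j) * b j)"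
    by (simp add: mu_def sum_distrib_left algebra_simps)
  then have "(norm (\<Sum>j=1..n. \<i> * of_real (mu j) * b j))\<^sup>2 =
      (norm (\<Sum>j=1..n. \<i> * of_real (lam j) * b j))\<^sup>2 / 4"
    using \<sigma> by (simp only: norm_mult norm_of_real power_mult_distrib) (simp add: power_divide)
  moreover have "(\<Sum>k=1..n. (mu k)\<^sup>2) = (\<Sum>k=1..n. (lam k)\<^sup>2) / 4"
    using \<sigma> by (simp add: mu_def power_mult_distrib power_divide sum_divide_distrib)
  ultimately have "(norm (\<Sum>j=1..n. \<i> * of_real (lam j) * b j))\<^sup>2 / 4
      \<le> (1 + eps n)\<^sup>2 * (27 * real n ^ 5 + (\<Sum>k=1..n. (lam k)\<^sup>2) / 4) * ?M\<^sup>2"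
    using bd by (simp only:)
  \<comment> \<open>The scale 1/2 puts a factor 1/4 on the squared derivative and on the squared
    frequencies alike; clearing it changes only the constant, from 27 to 108.\<close>
  also have "\<dots> = (1 + eps n)\<^sup>2 * (108 * real n ^ 5 + (\<Sum>k=1..n. (lam k)\<^sup>2)) * ?M\<^sup>2 / 4"
    by (simp add: field_simps)
  finally have "(norm (\<Sum>j=1..n. \<i> * of_real (lam j) * b j))\<^sup>2
      \<le> (1 + eps n)\<^sup>2 * (108 * real n ^ 5 + (\<Sum>k=1..n. (lam k)\<^sup>2)) * ?M\<^sup>2"
    by simp
  moreover have "0 \<le> ?M"
    by (rule order_trans[OF norm_ge_zero norm_expsum_le_supnorm01[OF t]])
  ultimately have "norm (\<Sum>j=1..n. \<i> * of_real (lam j) * b j)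
      \<le> (1 + eps n) * sqrt (108 * real n ^ 5 + (\<Sum>k=1..n. (lam k)\<^sup>2)) * ?M"
    by (intro le_mult_sqrt_mult one_plus_eps_nonneg add_nonneg_nonneg sum_nonneg) auto
  then show ?thesis
    using vector_derivative_at[OF has_vector_derivative_expsum[of n a lam t]] by (simp add: b_def)
qed

theorem theorem9p1:
  fixes n :: nat and a :: "nat \<Rightarrow> complex" and lam :: "nat \<Rightarrow> real"
  assumes "n \<ge> 1"
    and "strict_mono_on {1..n} lam"
  shows "(norm (vector_derivative (expsum n a lam) (at 0))
           \<le> (1 + eps n) * sqrt (27 * real n ^ 5 + (\<Sum>k=1..n. (lam k)\<^sup>2)) * supnorm01 (expsum n a lam)) \<and>
         (supnorm01 (\<lambda>t. vector_derivative (expsum n a lam) (at t))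
           \<le> (1 + eps n) * sqrt (108 * real n ^ 5 + (\<Sum>k=1..n. (lam k)\<^sup>2)) * supnorm01 (expsum n a lam))"
proof
  let ?M = "supnorm01 (expsum n a lam)"
  have M0: "0 \<le> ?M"
    using order_trans[OF norm_ge_zero norm_expsum_le_supnorm01[of 0 n a lam]] by simp
  have "vector_derivative (expsum n a lam) (at 0) = (\<Sum>j=1..n. \<i> * of_real (lam j) * a j)"
    using vector_derivative_at[OF has_vector_derivative_expsum[of n a lam 0]] by simp
  moreover have "norm (\<Sum>j=1..n. \<i> * of_real (lam j) * a j)
      \<le> (1 + eps n) * sqrt (27 * real n ^ 5 + (\<Sum>k=1..n. (lam k)\<^sup>2)) * ?M"
    using derivative_at_endpoint[OF assms(1) norm_expsum_le_supnorm01] M0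
    by (intro le_mult_sqrt_mult one_plus_eps_nonneg add_nonneg_nonneg sum_nonneg) auto
  ultimately show "norm (vector_derivative (expsum n a lam) (at 0))
      \<le> (1 + eps n) * sqrt (27 * real n ^ 5 + (\<Sum>k=1..n. (lam k)\<^sup>2)) * ?M"
    by simp
  show "supnorm01 (\<lambda>t. vector_derivative (expsum n a lam) (at t))
      \<le> (1 + eps n) * sqrt (108 * real n ^ 5 + (\<Sum>k=1..n. (lam k)\<^sup>2)) * ?M"
    unfolding supnorm01_def[of "\<lambda>t. vector_derivative (expsum n a lam) (at t)"]
  proof (rule cSUP_least)
    fix t :: real assume "t \<in> {0..1}"
    then show "norm (vector_derivative (expsum n a lam) (at t))
        \<le> (1 + eps n) * sqrt (108 * real n ^ 5 + (\<Sum>k=1..n. (lam k)\<^sup>2)) * ?M"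
      by (intro derivative_inside[OF assms(1)]) auto
  qed simp
qed

end
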